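(* Let $R_1^*,R_2^*,\ldots$ be the sequence of payouts (including Futurity awards) of the generalized Futurity slot machine, as defined in the context, starting in an arbitrary initial state $(X_0,Y_0)=(i_0,j_0)\in\{0,1,\ldots,I-1\}\times\{0,1,\ldots,J-1\}$. Then $$n^{-1}(R_1^*+\cdots+R_n^* )\to\mu^*\quad\text{almost surely as } n\to\infty,$$ where $$\mu^*:=\frac1I\sum_{i=0}^{I-1}\mu_i+Jp^\circ,\qquad p^\circ:=\frac{1}{I(1-Q)}\sum_{i=0}^{I-1}\sum_{k=1}^{d}q_iq_{i-1}\cdots q_{i-kJ+1}\,p_{i-kJ},\qquad Q:=q_0q_1\cdots q_{I-1},$$ with $p_i$ and $q_i$ extended to all integer indices $i$ periodically with period $I$.
   Context: Generalized Futurity slot machine. Let $J\ge2$ and $d\ge1$ be integers and $I:=dJ$. For each $i\in\{0,1,\ldots,I-1\}$ a bounded nonnegative payout distribution is given (the payout distribution in cam position $i$); it has probability $p_i$ of being nonzero, where $0<p_i<1$, mean $\mu_i$, and variance $\sigma_i^2$. Let $q_i:=1-p_i$. Fix $(i_0,j_0)\in\{0,\ldots,I-1\}\times\{0,\ldots,J-1\}$. Let $R_1,R_2,\ldots$ be independent random variables such that $R_n$ has the payout distribution in cam position $i$, where $i\in\{0,\ldots,I-1\}$ and $i\equiv i_0+n-1 \pmod I$ (payouts excluding Futurity awards). Let $X_0=i_0$, $X_n\equiv i_0+n\pmod I$ with $X_n\in\{0,\ldots,I-1\}$ (cam position after the $n$th coup), and let $Y_0=j_0$ and, for $n\ge1$,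 $Y_n=Y_{n-1}+1$ if $R_n=0$ and $Y_{n-1}\le J-2$, and $Y_n=0$ otherwise (pointer position: number of consecutive losses, reset to $0$ after a win or after $J$ consecutive losses). After $J$ consecutive losses the $J$ lost coins are returned (the Futurity award), so the payout at coup $n$ including the Futurity award is $$R_n^*:=R_n+J\cdot 1_{\{Y_{n-1}=J-1,\;R_n=0\}},\qquad n\ge1.$$ *)

theory Defs
  imports "HOL-Probability.Probability"
begin

definition payout_distribution :: "real measure \<Rightarrow> bool" where
  "payout_distribution D \<longleftrightarrow>
     prob_space D \<and> sets D = sets borel \<and> (\<exists>B. AE x in D. 0 \<le> x \<and> x \<le> B)"

definition win_prob :: "real measure \<Rightarrow> real" where
  "win_prob D = measure D {x. x \<noteq> 0}"

definition mean_payout :: "real measure \<Rightarrow> real" where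
  "mean_payout D = (LINT x|D. x)"

definition cam_position :: "nat \<Rightarrow> nat \<Rightarrow> nat \<Rightarrow> nat" where
  "cam_position I i0 n = (i0 + n) mod I"

(* In the next two definitions r is a realization of the payout sequence (excluding
   Futurity awards). It is indexed from 1; the value r 0 is never used. *)

primrec pointer_position :: "nat \<Rightarrow> nat \<Rightarrow> (nat \<Rightarrow> real) \<Rightarrow> nat \<Rightarrow> nat" where
  "pointer_position J j0 r 0 = j0"
| "pointer_position J j0 r (Suc n) =
     (if r (Suc n) = 0 \<and> pointer_position J j0 r n \<le> J - 2
      then pointer_position J j0 r n + 1 else 0)"

(* Meaningful for n at least 1. *)
definition total_payout :: "nat \<Rightarrow> nat \<Rightarrow> (nat \<Rightarrow> real) \<Rightarrow> nat \<Rightarrow> real" where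
  "total_payout J j0 r n =
     r n + real J * of_bool (pointer_position J j0 r (n - 1) = J - 1 \<and> r n = 0)"

definition periodic_ext :: "nat \<Rightarrow> (nat \<Rightarrow> real) \<Rightarrow> int \<Rightarrow> real" where
  "periodic_ext I f z = f (nat (z mod int I))"

(* The innermost product is q_i q_(i-1) ... q_(i-kJ+1), with indices modulo I = d J. *)
definition award_rate :: "nat \<Rightarrow> nat \<Rightarrow> (nat \<Rightarrow> real) \<Rightarrow> real" where
  "award_rate d J p =
     (let I = d * J;
          p' = periodic_ext I p;
          q' = (\<lambda>z. 1 - p' z);
          Q = (\<Prod>i<I. q' (int i))
      in 1 / (real I * (1 - Q)) *
         (\<Sum>i<I. \<Sum>k=1..d.
            (\<Prod>l<k * J. q' (int i - int l)) * p' (int i - int (k * J))))"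

definition futurity_mean :: "nat \<Rightarrow> nat \<Rightarrow> (nat \<Rightarrow> real measure) \<Rightarrow> real" where
  "futurity_mean d J D =
     1 / real (d * J) * (\<Sum>i<d * J. mean_payout (D i))
     + real J * award_rate d J (\<lambda>i. win_prob (D i))"

end

theory Submission
  imports Defs "HOL-Library.Discrete_Functions"
begin

text \<open>
  Let \<open>L\<^sub>k(n)\<close> indicate that coups \<open>n - k + 1, \<dots>, n\<close> are all lost. If the last win before or at
  coup \<open>n\<close> lies \<open>t\<close> coups back, an award is paid at coup \<open>n\<close> iff \<open>t\<close> is a positive multiple of \<open>J\<close>.
  Hence, whatever the initial pointer position, for \<open>n > K J\<close> the award indicator differs from
  \<open>\<Sum>\<^sub>1\<^sub>\<le>\<^sub>k\<^sub>\<le>\<^sub>K (L\<^sub>k\<^sub>J(n) - L\<^sub>k\<^sub>J\<^sub>+\<^sub>1(n))\<close> by at most \<open>L\<^sub>K\<^sub>J(n)\<close>. The sequence \<open>L\<^sub>k\<close> is bounded and finitely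
  dependent with periodic means, so its averages converge almost surely: the variance of its
  partial sums is linear, which gives convergence along the squares \<open>n\<^sup>2\<close>, and boundedness fills
  the gaps. For \<open>K = d s\<close> the error has limiting average \<open>Q\<^sup>s\<close>, and the approximating sum has the
  limiting average \<open>(1 - Q\<^sup>s) p\<^sup>\<circ>\<close>, because lengthening a run of losses by a full period multiplies
  its probability by \<open>Q\<close>. Let \<open>s\<close> tend to infinity.
\<close>

section \<open>Strong law for bounded, finitely dependent sequences\<close>

lemma floor_sqrt_at_top: "filterlim floor_sqrt at_top sequentially"
  unfolding filterlim_at_top
proof
  fix Z :: nat
  show "eventually (\<lambda>n. Z \<le> floor_sqrt n) sequentially"
    using eventually_ge_at_top[of "Z^2"] by eventually_elim (simp add: le_floor_sqrt_iff)
qed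

text \<open>If \<open>k^2 <= n < (k+1)^2\<close>, the sum up to \<open>n\<close> has at most
  \<open>2 * k\<close> terms beyond the sum up to \<open>k^2\<close>. After division by
  \<open>n >= k^2\<close> they contribute at most \<open>2 * C / k\<close>.\<close>

lemma average_tendsto_0_of_squares:
  fixes x :: "nat \<Rightarrow> real"
  assumes bound: "\<And>n. \<bar>x n\<bar> \<le> C"
    and squares: "(\<lambda>n. (\<Sum>m<n^2. x m) / real (n^2)) \<longlonglongrightarrow> 0"
  shows "(\<lambda>n. (\<Sum>m<n. x m) / real n) \<longlonglongrightarrow> 0"
proof -
  define y where "y n = \<bar>(\<Sum>m<n^2. x m) / real (n^2)\<bar> + 2 * C / real n" for n
  have "(\<lambda>n. 2 * C / real n) \<longlonglongrightarrow> 0"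
    by (rule lim_const_over_n)
  then have "y \<longlonglongrightarrow> 0"
    using tendsto_rabs_zero[OF squares] unfolding y_def by (intro tendsto_add_zero) auto
  then have lim: "(\<lambda>n. y (floor_sqrt n)) \<longlonglongrightarrow> 0"
    using floor_sqrt_at_top by (rule filterlim_compose)
  have C: "0 \<le> C" using bound[of 0] by linarith
  have "\<bar>(\<Sum>m<n. x m) / real n\<bar> \<le> y (floor_sqrt n)" if "n \<ge> 1" for n
  proof -
    define k where "k = floor_sqrt n"
    have k: "k^2 \<le> n" "n < (Suc k)^2" "k \<ge> 1"
      using that Suc_floor_sqrt_power2_gt[of n] floor_sqrt_greater_zero_iff[of n] 
      by (auto simp: k_def simp del: floor_sqrt_greater_zero_iff)
    \<comment> \<open>This is where consecutive squares being close matters: the gap is of smaller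
      order than \<open>k^2\<close>.\<close>
    have diff: "n - k^2 \<le> 2 * k" using k(2) by (simp add: power2_eq_square)
    have "(\<Sum>m<n. x m) = (\<Sum>m<k^2. x m) + (\<Sum>m\<in>{k^2..<n}. x m)"
      using k(1) by (metis atLeast0LessThan le0 sum.atLeastLessThan_concat)
    moreover have "\<bar>\<Sum>m\<in>{k^2..<n}. x m\<bar> \<le> real (n - k^2) * C"
      using sum_norm_bound[of "{k^2..<n}" x C] bound by simp
    moreover have "real (n - k^2) * C \<le> real (2 * k) * C"
      using diff C by (intro mult_right_mono) (simp_all only: of_nat_le_iff)
    ultimately have "\<bar>\<Sum>m<n. x m\<bar> \<le> \<bar>\<Sum>m<k^2. x m\<bar> + 2 * k * C"
      by simp
    then have "\<bar>\<Sum>m<n. x m\<bar> / n \<le> (\<bar>\<Sum>m<k^2. x m\<bar> + 2 * k * C) / n"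
      by (intro divide_right_mono) auto
    also have "\<dots> \<le> (\<bar>\<Sum>m<k^2. x m\<bar> + 2 * k * C) / real (k^2)"
      using k C that by (intro divide_left_mono mult_pos_pos add_nonneg_nonneg) (simp_all flip: of_nat_power)
    also have "\<dots> = y k"
      using k(3) by (simp add: y_def add_divide_distrib power2_eq_square)
    finally show ?thesis by (simp add: k_def)
  qed
  then have "eventually (\<lambda>n. norm ((\<Sum>m<n. x m) / real n) \<le> y (floor_sqrt n)) sequentially"
    unfolding eventually_sequentially by auto
  then show ?thesis
    by (rule Lim_null_comparison[OF _ lim])
qed

context prob_space
begin

text \<open>The average over \<open>n^2\<close> terms has second moment at most
  \<open>V / n^2\<close>, which is summable. So the squared averages have an almost surely finite
  sum and tend to 0 along the squares; boundedness then covers all \<open>n\<close>.\<close>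

lemma AE_average_tendsto_0_of_linear_variance:
  fixes X :: "nat \<Rightarrow> 'a \<Rightarrow> real"
  assumes [measurable]: "\<And>n. random_variable borel (X n)"
    and bound: "\<And>n. AE \<omega> in M. \<bar>X n \<omega>\<bar> \<le> C"
    and var: "\<And>n. expectation (\<lambda>\<omega>. (\<Sum>m<n. X m \<omega>)^2) \<le> V * real n"
  shows "AE \<omega> in M. (\<lambda>n. (\<Sum>m<n. X m \<omega>) / real n) \<longlonglongrightarrow> 0"
proof -
  have AEb: "AE \<omega> in M. \<forall>n. \<bar>X n \<omega>\<bar> \<le> C"
    using bound by (simp add: AE_all_countable)
  define S where "S n \<omega> = (\<Sum>m<n^2. X m \<omega>) / real (n^2)" for n \<omega>
  have [measurable]: "S n \<in> borel_measurable M" for n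
    unfolding S_def by measurable
  have sq: "(\<integral>\<^sup>+\<omega>. ennreal ((S n \<omega>)^2) \<partial>M) \<le> ennreal (V / real n ^ 2)" for n
  proof -
    \<comment> \<open>This crude bound serves only to make the square integrable.\<close>
    have "AE \<omega> in M. norm ((\<Sum>m<n^2. X m \<omega>)^2) \<le> (real (n^2) * C)^2"
      using AEb
    proof eventually_elim
      case (elim \<omega>)
      then have "\<bar>\<Sum>m<n^2. X m \<omega>\<bar> \<le> real (n^2) * C"
        using sum_norm_bound[of "{..<n^2}" "\<lambda>m. X m \<omega>" C] by simp
      then show ?case
        by (metis abs_le_square_iff abs_ge_zero abs_of_nonneg norm_power order_trans power2_abs real_norm_def)
    qed
    then have int: "integrable M (\<lambda>\<omega>. (\<Sum>m<n^2. X m \<omega>)^2)"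
      by (intro integrable_const_bound) auto
    have eq: "(S n \<omega>)^2 = (\<Sum>m<n^2. X m \<omega>)^2 / real n ^ 4" for \<omega>
      unfolding S_def power_divide by (simp flip: power_mult)
    have "(\<integral>\<^sup>+\<omega>. ennreal ((S n \<omega>)^2) \<partial>M) = ennreal (expectation (\<lambda>\<omega>. (S n \<omega>)^2))"
      unfolding eq using int by (intro nn_integral_eq_integral) auto
    also have "expectation (\<lambda>\<omega>. (S n \<omega>)^2) = expectation (\<lambda>\<omega>. (\<Sum>m<n^2. X m \<omega>)^2) / real n ^ 4"
      unfolding eq using int by simp
    also have "\<dots> \<le> V * real (n^2) / real n ^ 4"
      by (intro divide_right_mono var) auto
    \<comment> \<open>At \<open>n = 0\<close> both sides are 0, since division by zero yields
      0.\<close>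
    also have "\<dots> = V / real n ^ 2"
      by (cases "n = 0") (simp_all add: field_simps power2_eq_square power4_eq_xxxx)
    finally show ?thesis by (simp add: ennreal_leI)
  qed
  \<comment> \<open>The case \<open>n = 1\<close> of the variance bound forces the sign of
    \<open>V\<close>, which the passage from \<open>ennreal\<close> series to real series
    requires.\<close>
  have V: "0 \<le> V"
    using order_trans[OF Bochner_Integration.integral_nonneg var[of 1]] by simp
  have "(\<integral>\<^sup>+\<omega>. (\<Sum>n. ennreal ((S n \<omega>)^2)) \<partial>M) = (\<Sum>n. \<integral>\<^sup>+\<omega>. ennreal ((S n \<omega>)^2) \<partial>M)"
    by (intro nn_integral_suminf) auto
  also have "\<dots> \<le> (\<Sum>n. ennreal (V / real n ^ 2))"
    by (intro suminf_le sq) auto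
  also have "\<dots> = ennreal (\<Sum>n. V / real n ^ 2)"
  proof (rule suminf_ennreal2)
    show "summable (\<lambda>n. V / real n ^ 2)"
      using summable_mult[OF inverse_power_summable[of 2, where 'a=real], of V]
      by (simp add: divide_inverse)
  qed (use V in auto)
  finally have "(\<integral>\<^sup>+\<omega>. (\<Sum>n. ennreal ((S n \<omega>)^2)) \<partial>M) \<noteq> \<infinity>"
    by (auto simp: top_unique)
  then have "AE \<omega> in M. (\<Sum>n. ennreal ((S n \<omega>)^2)) \<noteq> \<infinity>"
    by (intro nn_integral_PInf_AE) auto
  then show ?thesis using AEb
  proof eventually_elim
    case (elim \<omega>)
    then have "summable (\<lambda>n. (S n \<omega>)^2)"
      by (intro summable_suminf_not_top) auto
    then have "(\<lambda>n. (S n \<omega>)^2) \<longlonglongrightarrow> 0" by (rule summable_LIMSEQ_zero)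
    then have "(\<lambda>n. S n \<omega>) \<longlonglongrightarrow> 0"
      using tendsto_real_sqrt by (fastforce intro: tendsto_rabs_zero_cancel)
    then show ?case
      using elim by (intro average_tendsto_0_of_squares[where C=C]) (auto simp: S_def)
  qed
qed

text \<open>In the expanded square each row has at most \<open>2 * k + 1\<close> entries within
  distance \<open>k\<close> of the diagonal, each of expectation at most \<open>C^2\<close>; all
  other entries vanish. Hence the second moment grows linearly.\<close>

lemma AE_average_tendsto_0_of_finite_range:
  fixes X :: "nat \<Rightarrow> 'a \<Rightarrow> real"
  assumes [measurable]: "\<And>n. random_variable borel (X n)"
    and bound: "\<And>n. AE \<omega> in M. \<bar>X n \<omega>\<bar> \<le> C"
    and uncorr: "\<And>m n. m + k \<le> n \<Longrightarrow> expectation (\<lambda>\<omega>. X m \<omega> * X n \<omega>) = 0"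
  shows "AE \<omega> in M. (\<lambda>n. (\<Sum>m<n. X m \<omega>) / real n) \<longlonglongrightarrow> 0"
proof (rule AE_average_tendsto_0_of_linear_variance)
  fix n
  have AEp: "AE \<omega> in M. norm (X m \<omega> * X l \<omega>) \<le> C^2" for m l
    using bound[of m] bound[of l]
    by eventually_elim (auto simp: abs_mult power2_eq_square intro!: mult_mono)
  have int: "integrable M (\<lambda>\<omega>. X m \<omega> * X l \<omega>)" for m l
    by (rule integrable_const_bound[OF AEp]) measurable
  have le: "expectation (\<lambda>\<omega>. X m \<omega> * X l \<omega>) \<le> C^2 * of_bool (m \<le> l + k \<and> l \<le> m + k)" for m l
  proof (cases "m \<le> l + k \<and> l \<le> m + k")
    case True
    have "expectation (\<lambda>\<omega>. X m \<omega> * X l \<omega>) \<le> C^2"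
      by (rule integral_le_const[OF int]) (use AEp[of m l] in auto)
    then show ?thesis using True by simp
  next
    case False
    then show ?thesis using uncorr[of m l] uncorr[of l m] by (auto simp: mult.commute)
  qed
  have count: "(\<Sum>l<n. of_bool (m \<le> l + k \<and> l \<le> m + k)) \<le> (2 * real k + 1)" for m
  proof -
    have "card {l. l < n \<and> m \<le> l + k \<and> l \<le> m + k} \<le> card {m - k..m + k}"
      by (intro card_mono) auto
    also have "\<dots> \<le> 2 * k + 1" by simp
    finally have "real (card {l. l < n \<and> m \<le> l + k \<and> l \<le> m + k}) \<le> real (2 * k + 1)"
      by (simp only: of_nat_le_iff)
    then show ?thesis
      by (simp add: of_bool_def sum.If_cases Int_def)
  qed
  have "expectation (\<lambda>\<omega>. (\<Sum>m<n. X m \<omega>)^2) = (\<Sum>m<n. \<Sum>l<n. expectation (\<lambda>\<omega>. X m \<omega> * X l \<omega>))"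
    unfolding power2_eq_square sum_product using int by simp
  also have "\<dots> \<le> (\<Sum>m<n. \<Sum>l<n. C^2 * of_bool (m \<le> l + k \<and> l \<le> m + k))"
    by (intro sum_mono le)
  also have "\<dots> = (\<Sum>m<n. C^2 * (\<Sum>l<n. of_bool (m \<le> l + k \<and> l \<le> m + k)))"
    by (simp only: sum_distrib_left)
  also have "\<dots> \<le> (\<Sum>m<n. C^2 * (2 * real k + 1))"
    by (intro sum_mono mult_left_mono count) auto
  finally show "expectation (\<lambda>\<omega>. (\<Sum>m<n. X m \<omega>)^2) \<le> (C^2 * (2 * real k + 1)) * real n"
    by (simp add: mult_ac)
qed (use bound in auto)

end

section \<open>Deterministic facts on limits and periodic averages\<close>

text \<open>The approximants may change with \<open>e\<close>, and the error bound \<open>v\<close>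
  needs only a small limit, not a zero one. This fits truncated runs of losses, whose error has
  limiting average \<open>Q ^ s\<close>.\<close>

lemma tendsto_of_approximations:
  fixes a :: "nat \<Rightarrow> real"
  assumes "\<And>e. 0 < e \<Longrightarrow> \<exists>u v s t. u \<longlonglongrightarrow> s \<and> v \<longlonglongrightarrow> t \<and> (\<forall>n. \<bar>a n - u n\<bar> \<le> v n) \<and> \<bar>s - c\<bar> + t < e"
  shows "a \<longlonglongrightarrow> c"
proof (rule tendstoI)
  fix e :: real assume "0 < e"
  then obtain u v s t where *: "u \<longlonglongrightarrow> s" "v \<longlonglongrightarrow> t" "\<And>n. \<bar>a n - u n\<bar> \<le> v n" "\<bar>s - c\<bar> + t < e"
    using assms by blast
  have "(\<lambda>n. \<bar>u n - c\<bar> + v n) \<longlonglongrightarrow> \<bar>s - c\<bar> + t"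
    using * by (intro tendsto_intros)
  then have "eventually (\<lambda>n. \<bar>u n - c\<bar> + v n < e) sequentially"
    using *(4) by (rule order_tendstoD)
  then show "eventually (\<lambda>n. dist (a n) c < e) sequentially"
  proof eventually_elim
    case (elim n)
    with *(3)[of n] show ?case unfolding dist_real_def by linarith
  qed
qed

text \<open>The two sums differ by at most \<open>N\<close> terms at each end. This allows the first
  \<open>N\<close> coups, where long windows do not fit, to be dropped.\<close>

lemma average_shift_difference:
  fixes x :: "nat \<Rightarrow> real"
  assumes bound: "\<And>n. \<bar>x n\<bar> \<le> C"
  shows "(\<lambda>n. (\<Sum>m<n. x m) / real n - (\<Sum>m<n. x (m + N)) / real n) \<longlonglongrightarrow> 0"
proof (rule Lim_null_comparison)
  have C: "0 \<le> C" using bound[of 0] by linarith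
  have "\<bar>(\<Sum>m<n. x (m + N)) - (\<Sum>m<n. x m)\<bar> \<le> 2 * real N * C" for n
  proof -
    have "\<bar>(\<Sum>m<n. x (m + N)) - (\<Sum>m<n. x m)\<bar> = \<bar>(\<Sum>m<N. x (m + n)) - (\<Sum>m<N. x m)\<bar>"
    proof -
      \<comment> \<open>The first \<open>n + N\<close> terms are split once after \<open>n\<close>
        and once after \<open>N\<close>.\<close>
      have "(\<Sum>m<n. x m) + (\<Sum>m<N. x (m + n)) = (\<Sum>m<n + N. x m)" for n N
        by (induction N) (simp_all add: add.commute)
      from this[of n N] this[of N n] show ?thesis by (simp add: add.commute)
    qed
    also have "\<dots> \<le> \<bar>\<Sum>m<N. x (m + n)\<bar> + \<bar>\<Sum>m<N. x m\<bar>" by simp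
    also have "\<dots> \<le> real N * C + real N * C"
      using sum_norm_bound[of "{..<N}" "\<lambda>m. x (m + n)" C] sum_norm_bound[of "{..<N}" x C] bound
      by (intro add_mono) simp_all
    finally show ?thesis by (simp add: mult_ac)
  qed
  then show "eventually (\<lambda>n. norm ((\<Sum>m<n. x m) / real n - (\<Sum>m<n. x (m + N)) / real n) \<le> 2 * real N * C / real n) sequentially"
    by (intro always_eventually allI) (simp add: abs_minus_commute divide_right_mono flip: diff_divide_distrib)
qed (rule lim_const_over_n)

text \<open>Moving the window by one step trades \<open>g a\<close> for the equal value
  \<open>g (a + int I)\<close>. Working in \<open>comm_monoid_set\<close> yields the sum and the
  product version at once.\<close>

lemma (in comm_monoid_set) period_shift:
  fixes g :: "int \<Rightarrow> 'a"
  assumes per: "\<And>z. g (z + int I) = g z"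
  shows "F (\<lambda>i. g (a + int i)) {..<I} = F (\<lambda>i. g (int i)) {..<I}"
proof -
  have step: "F (\<lambda>i. g (a + 1 + int i)) {..<I} = F (\<lambda>i. g (a + int i)) {..<I}" for a
  proof (cases I)
    case (Suc I')
    have "F (\<lambda>i. g (a + 1 + int i)) {..<I} = f (F (\<lambda>i. g (a + 1 + int i)) {..<I'}) (g (a + int I))"
      by (simp add: Suc lessThan_Suc commute algebra_simps)
    also have "\<dots> = f (g (a + int 0)) (F (\<lambda>i. g (a + int (Suc i))) {..<I'})"
      by (simp add: per commute algebra_simps)
    also have "\<dots> = F (\<lambda>i. g (a + int i)) {..<I}"
      unfolding Suc lessThan_Suc_shift ..
    finally show ?thesis .
  qed simp
  show ?thesis
  proof (induction a rule: int_induct[where k = 0])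
    case (step2 i)
    then show ?case using step[of "i - 1"] by simp
  qed (simp_all add: step)
qed

text \<open>The deviation \<open>P n\<close> of the partial sum from \<open>n\<close> times the mean
  over a period is itself periodic, hence bounded, and vanishes after division by
  \<open>n\<close>.\<close>

lemma periodic_average:
  fixes c :: "int \<Rightarrow> real"
  assumes I: "I > 0" and per: "\<And>z. c (z + int I) = c z"
  shows "(\<lambda>n. (\<Sum>m<n. c (a + int m)) / real n) \<longlonglongrightarrow> (\<Sum>i<I. c (int i)) / real I"
proof -
  define T where "T = (\<Sum>i<I. c (int i))"
  define P where "P n = (\<Sum>m<n. c (a + int m)) - real n * (T / real I)" for n
  have P_add: "P (n + I) = P n" for n
  proof -
    have "(\<Sum>m<n + I. c (a + int m)) = (\<Sum>m<n. c (a + int m)) + (\<Sum>m<I. c ((a + int n) + int m))"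
      for I by (induction I) (simp_all add: algebra_simps)
    then show ?thesis
      using I sum.period_shift[of c I "a + int n", OF per] by (simp add: P_def T_def field_simps)
  qed
  have P_mod: "P (r + I * k) = P r" for r k
  proof (induction k)
    case (Suc k)
    then show ?case using P_add[of "r + I * k"] by (simp add: algebra_simps)
  qed simp
  have P_bound: "\<bar>P n\<bar> \<le> (\<Sum>r<I. \<bar>P r\<bar>)" for n
    using P_mod[of "n mod I" "n div I"] I
    by (auto intro!: member_le_sum[of "n mod I" _ "\<lambda>r. \<bar>P r\<bar>"])
  have "(\<lambda>n. P n / real n) \<longlonglongrightarrow> 0"
    by (rule Lim_null_comparison[OF _ lim_const_over_n[of "\<Sum>r<I. \<bar>P r\<bar>"]])
       (auto intro!: always_eventually divide_right_mono P_bound)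
  then have "(\<lambda>n. P n / real n + T / real I) \<longlonglongrightarrow> 0 + T / real I"
    by (intro tendsto_intros)
  moreover have "eventually (\<lambda>n. P n / real n + T / real I = (\<Sum>m<n. c (a + int m)) / real n) sequentially"
    using eventually_gt_at_top[of 0]
    by eventually_elim (simp add: P_def diff_divide_distrib)
  ultimately show ?thesis
    unfolding T_def by (auto elim: Lim_transform_eventually)
qed

section \<open>Products of periodic factors over backward windows\<close>

text \<open>For loss probabilities \<open>q\<close> this is the probability that \<open>k\<close>
  consecutive coups, the last one played in cam position \<open>z\<close> modulo the period, are all
  lost.\<close>

definition backward_prod :: "(int \<Rightarrow> real) \<Rightarrow> nat \<Rightarrow> int \<Rightarrow> real" where
  "backward_prod q k z = (\<Prod>l<k. q (z - int l))"

lemma backward_prod_Suc: "backward_prod q (Suc k) z = backward_prod q k z * q (z - int k)"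
  by (simp add: backward_prod_def)

lemma backward_prod_period_add:
  assumes per: "\<And>z. q (z + int I) = q z"
  shows "backward_prod q k (z + int I) = backward_prod q k z"
  using per[of "z - int l" for l] by (simp add: backward_prod_def algebra_simps)

text \<open>A window of length \<open>I\<close> meets every residue class once; reading it upwards
  reduces the claim to \<open>period_shift\<close>.\<close>

lemma backward_prod_period:
  assumes per: "\<And>z. q (z + int I) = q z"
  shows "backward_prod q I z = (\<Prod>i<I. q (int i))"
proof -
  have "backward_prod q I z = (\<Prod>i<I. q (z - int (I - Suc i)))"
    unfolding backward_prod_def by (rule prod.nat_diff_reindex[symmetric])
  also have "\<dots> = (\<Prod>i<I. q ((z - int I + 1) + int i))"
    by (intro prod.cong arg_cong[of _ _ q]) auto
  also have "\<dots> = (\<Prod>i<I. q (int i))"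
    by (rule prod.period_shift) (rule per)
  finally show ?thesis .
qed

lemma backward_prod_add_period:
  assumes per: "\<And>z. q (z + int I) = q z"
  shows "backward_prod q (k + I) z = (\<Prod>i<I. q (int i)) * backward_prod q k z"
proof (induction k)
  case 0
  show ?case by (simp add: backward_prod_period[of q, OF per]) (simp add: backward_prod_def)
next
  case (Suc k)
  have "q (z - int (k + I)) = q (z - int k)"
    using per[of "z - int (k + I)"] by simp
  then show ?case using Suc by (simp add: backward_prod_Suc)
qed

lemma backward_prod_power:
  assumes per: "\<And>z. q (z + int I) = q z"
  shows "backward_prod q (I * m) z = (\<Prod>i<I. q (int i)) ^ m"
proof (induction m)
  case 0
  show ?case by (simp add: backward_prod_def)
next
  case (Suc m)
  then show ?case using backward_prod_add_period[of q I "I * m" z, OF per] by (simp add: add.commute)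
qed

text \<open>Each block of \<open>d\<close> terms is \<open>Q\<close> times the preceding one, so
  this is a geometric sum of blocks. The induction splits off the first block and scales the rest by
  \<open>Q\<close>.\<close>

lemma geometric_block_sum:
  fixes e :: "nat \<Rightarrow> 'a :: comm_ring_1"
  assumes "\<And>k. e (k + d) = Q * e k"
  shows "(1 - Q) * (\<Sum>k<d * m. e k) = (1 - Q ^ m) * (\<Sum>k<d. e k)"
proof (induction m)
  case (Suc m)
  have "(\<Sum>k<d + b. e k) = (\<Sum>k<d. e k) + Q * (\<Sum>k<b. e k)" for b
    using assms by (induction b) (simp_all add: algebra_simps)
  from this[of "d * m"]
  have "(1 - Q) * (\<Sum>k<d * Suc m. e k) = (1 - Q) * (\<Sum>k<d. e k) + Q * ((1 - Q) * (\<Sum>k<d * m. e k))"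
    unfolding mult_Suc_right by (simp only:) (simp add: algebra_simps)
  then show ?case unfolding Suc by (simp add: algebra_simps)
qed simp

section \<open>Awards expressed by runs of losses, path by path\<close>

text \<open>The indicator is real-valued so that it can be averaged. Subtraction on naturals
  truncates, so it describes actual coups only for \<open>k <= n\<close>.\<close>

definition loss_run :: "(nat \<Rightarrow> real) \<Rightarrow> nat \<Rightarrow> nat \<Rightarrow> real" where
  "loss_run r k n = of_bool (\<forall>l<k. r (n - l) = 0)"

definition award :: "nat \<Rightarrow> nat \<Rightarrow> (nat \<Rightarrow> real) \<Rightarrow> nat \<Rightarrow> real" where
  "award J j0 r n = of_bool (pointer_position J j0 r (n - 1) = J - 1 \<and> r n = 0)"

lemma total_payout_eq: "total_payout J j0 r n = r n + real J * award J j0 r n"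
  by (simp add: total_payout_def award_def)

text \<open>A win sets the pointer to 0, and each later loss acts on it as the successor modulo
  \<open>J\<close>. After the first win the initial position \<open>j0\<close> is thus
  forgotten.\<close>

lemma pointer_position_after_win:
  assumes "J \<ge> 2" "r n \<noteq> 0" "n \<ge> 1" "\<And>i. n < i \<Longrightarrow> i \<le> n + t \<Longrightarrow> r i = 0"
  shows "pointer_position J j0 r (n + t) = t mod J"
  using assms(4)
proof (induction t)
  case 0
  then show ?case using assms by (cases n) auto
next
  case (Suc t)
  then have IH: "pointer_position J j0 r (n + t) = t mod J" by simp
  have "t mod J < J" using assms by simp
  then have "Suc (t mod J) = J \<longleftrightarrow> \<not> t mod J \<le> J - 2" using \<open>J \<ge> 2\<close> by linarith
  then show ?case using Suc.prems[of "Suc (n + t)"] \<open>J \<ge> 2\<close>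
    by (simp add: IH mod_Suc)
qed

text \<open>Each difference indicates that the losing run ending at coup \<open>n\<close> has length
  exactly \<open>Suc k * J\<close>. If a win occurred at most \<open>K * J\<close> coups back, the
  sum equals the award; otherwise the right-hand side is 1.\<close>

lemma award_eq_loss_runs:
  assumes J: "J \<ge> 2" and n: "K * J < n"
  shows "\<bar>award J j0 r n - (\<Sum>k<K. loss_run r (Suc k * J) n - loss_run r (Suc (Suc k * J)) n)\<bar>
    \<le> loss_run r (K * J) n"
proof (cases "\<exists>t \<le> K * J. r (n - t) \<noteq> 0")
  case True
  \<comment> \<open>\<open>t\<close> is the length of the losing run that ends at coup
    \<open>n\<close>.\<close>
  define t where "t = (LEAST t. r (n - t) \<noteq> 0)"
  obtain t' where t': "t' \<le> K * J" "r (n - t') \<noteq> 0"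
    using True by blast
  have t: "r (n - t) \<noteq> 0" "t \<le> K * J"
    using LeastI[of "\<lambda>t. r (n - t) \<noteq> 0", OF t'(2)] Least_le[of "\<lambda>t. r (n - t) \<noteq> 0", OF t'(2)] t'(1)
    unfolding t_def by simp_all
  have tl: "r (n - l) = 0" if "l < t" for l
    using not_less_Least[of l "\<lambda>t. r (n - t) \<noteq> 0"] that unfolding t_def by blast
  have run: "loss_run r k n = of_bool (k \<le> t)" for k
    using t(1) tl unfolding loss_run_def by (auto simp: not_le)
  have "(\<Sum>k<K. loss_run r (Suc k * J) n - loss_run r (Suc (Suc k * J)) n)
      = (\<Sum>k<K. of_bool (Suc k * J = t))"
    unfolding run by (intro sum.cong) auto
  also have "\<dots> = of_bool (0 < t \<and> J dvd t)"
  proof (cases "0 < t \<and> J dvd t")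
    case True
    then obtain s where s: "t = Suc s * J" using J by (metis dvdE mult.commute mult_0_right not0_implies_Suc not_gr0)
    have "s < K" using t(2) J unfolding s by (simp del: mult_Suc)
    have "(\<Sum>k<K. of_bool (Suc k * J = t)) = (\<Sum>k<K. of_bool (k = s) :: real)"
      using J unfolding s by (intro sum.cong) (auto simp del: mult_Suc)
    then show ?thesis using True \<open>s < K\<close> by (simp add: of_bool_def)
  next
    case False
    then show ?thesis using J by (auto intro!: sum.neutral simp: of_bool_def simp del: mult_Suc)
  qed
  also have "\<dots> = award J j0 r n"
  proof (cases t)
    case 0
    then show ?thesis using t by (simp add: award_def)
  next
    case (Suc s)
    \<comment> \<open>The award depends on the pointer before coup \<open>n\<close>, when only
      \<open>s = t - 1\<close> losses have followed the win.\<close>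
    have "pointer_position J j0 r ((n - t) + s) = s mod J"
    proof (rule pointer_position_after_win)
      fix i assume "n - t < i" "i \<le> n - t + s"
      then show "r i = 0" using tl[of "n - i"] n t Suc by simp
    qed (use J t n in auto)
    moreover have "n - t + s = n - 1" using Suc n t by simp
    moreover have "s mod J = J - 1 \<longleftrightarrow> J dvd t"
      using J unfolding Suc dvd_eq_mod_eq_0 by (auto simp: mod_Suc)
    ultimately show ?thesis using tl[of 0] Suc by (simp add: award_def)
  qed
  finally show ?thesis by (simp add: loss_run_def)
next
  case False
  \<comment> \<open>All runs that occur are present, so the differences cancel and the error is the
    award itself, which is at most 1.\<close>
  then have one: "loss_run r k n = 1" if "k \<le> Suc (K * J)" for k
    using that by (auto simp: loss_run_def)
  have "Suc k * J \<le> K * J" if "k < K" for k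
    using that by (intro mult_le_mono1) simp
  then have "(\<Sum>k<K. loss_run r (Suc k * J) n - loss_run r (Suc (Suc k * J)) n) = 0"
    by (intro sum.neutral) (auto simp: one le_SucI simp del: mult_Suc)
  then show ?thesis by (simp add: award_def one del: mult_Suc)
qed

section \<open>Averages of products over sliding windows\<close>

context prob_space
begin

text \<open>Products over disjoint windows are uncorrelated, so the centred products have dependence
  range \<open>k\<close>. The offset \<open>N\<close> keeps every index at least 1.\<close>

lemma AE_average_window_products:
  fixes Z :: "nat \<Rightarrow> 'a \<Rightarrow> real"
  assumes indep: "indep_vars (\<lambda>_. borel) Z {1..}"
    and bound: "\<And>i. i \<ge> 1 \<Longrightarrow> AE \<omega> in M. \<bar>Z i \<omega>\<bar> \<le> C"
    and k: "k \<le> Suc N"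
  shows "AE \<omega> in M. (\<lambda>n. (\<Sum>m<n. (\<Prod>l<k. Z (Suc (m + N) - l) \<omega>)
      - (\<Prod>l<k. expectation (Z (Suc (m + N) - l)))) / real n) \<longlonglongrightarrow> 0"
proof -
  \<comment> \<open>As index sets, two disjoint windows merge into one finite product, to which the
    product rule for independent variables applies.\<close>
  define S where "S m = (\<lambda>l. Suc (m + N) - l) ` {..<k}" for m
  have S: "finite (S m)" "S m \<subseteq> {1..}" for m
    using k by (auto simp: S_def)
  have prod_S: "(\<Prod>l<k. f (Suc (m + N) - l)) = prod f (S m)" for f :: "nat \<Rightarrow> real" and m
  proof -
    have "inj_on (\<lambda>l. Suc (m + N) - l) {..<k}"
      using k by (auto intro!: inj_onI)
    then show ?thesis by (simp add: S_def prod.reindex)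
  qed
  have [measurable]: "random_variable borel (Z i)" if "i \<in> {1..}" for i
    using indep that by (simp add: indep_vars_def)
  have Z_int: "integrable M (Z i)" if "i \<in> {1..}" for i
    using that bound[of i] by (intro integrable_const_bound[where B = C]) auto
  have AEZ: "AE \<omega> in M. \<forall>i\<in>{1..}. \<bar>Z i \<omega>\<bar> \<le> C"
    using bound by (simp add: AE_ball_countable)
  have E_prod: "expectation (\<lambda>\<omega>. \<Prod>i\<in>T. Z i \<omega>) = (\<Prod>i\<in>T. expectation (Z i))"
    and I_prod: "integrable M (\<lambda>\<omega>. \<Prod>i\<in>T. Z i \<omega>)"
    if T: "finite T" "T \<subseteq> {1..}" for T
    using T indep_vars_lebesgue_integral[OF T(1) indep_vars_subset[OF indep T(2)]]
      indep_vars_integrable[OF T(1) indep_vars_subset[OF indep T(2)]] Z_int by auto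
  define W where "W m \<omega> = (\<Prod>i\<in>S m. Z i \<omega>)" for m \<omega>
  define w where "w m = (\<Prod>i\<in>S m. expectation (Z i))" for m
  have W_int: "integrable M (W m)" and W_exp: "expectation (W m) = w m" for m
    using E_prod[OF S, of m] I_prod[OF S, of m] unfolding W_def w_def by auto
  have WW: "integrable M (\<lambda>\<omega>. W m \<omega> * W n \<omega>)" "expectation (\<lambda>\<omega>. W m \<omega> * W n \<omega>) = w m * w n"
    if "m + k \<le> n" for m n
  proof -
    have disj: "S m \<inter> S n = {}"
      using that k by (auto simp: S_def)
    have "W m \<omega> * W n \<omega> = (\<Prod>i\<in>S m \<union> S n. Z i \<omega>)" for \<omega>
      unfolding W_def by (rule prod.union_disjoint[symmetric]) (use S disj in auto)
    moreover have "w m * w n = (\<Prod>i\<in>S m \<union> S n. expectation (Z i))"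
      unfolding w_def by (rule prod.union_disjoint[symmetric]) (use S disj in auto)
    ultimately show "integrable M (\<lambda>\<omega>. W m \<omega> * W n \<omega>)" "expectation (\<lambda>\<omega>. W m \<omega> * W n \<omega>) = w m * w n"
      using E_prod[of "S m \<union> S n"] I_prod[of "S m \<union> S n"] S by simp_all
  qed
  have W_bound: "AE \<omega> in M. norm (W m \<omega>) \<le> C ^ k" for m
    using AEZ
  proof eventually_elim
    case (elim \<omega>)
    have "\<bar>W m \<omega>\<bar> = (\<Prod>l<k. \<bar>Z (Suc (m + N) - l) \<omega>\<bar>)"
      unfolding W_def prod_S[symmetric] abs_prod ..
    also have "\<dots> \<le> (\<Prod>l<k. C)"
      using elim k by (intro prod_mono) auto
    finally show ?case by simp
  qed
  have w_bound: "\<bar>w m\<bar> \<le> C ^ k" for m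
  proof -
    have "\<bar>w m\<bar> \<le> expectation (\<lambda>\<omega>. norm (W m \<omega>))"
      unfolding W_exp[symmetric] using integral_norm_bound[of M "W m"] by simp
    also have "\<dots> \<le> C ^ k"
      using W_bound[of m] W_int by (intro integral_le_const) auto
    finally show ?thesis .
  qed
  have "AE \<omega> in M. (\<lambda>n. (\<Sum>m<n. W m \<omega> - w m) / real n) \<longlonglongrightarrow> 0"
  proof (rule AE_average_tendsto_0_of_finite_range)
    show "(\<lambda>\<omega>. W m \<omega> - w m) \<in> borel_measurable M" for m
      using W_int[of m] by auto
    show "AE \<omega> in M. \<bar>W m \<omega> - w m\<bar> \<le> 2 * C ^ k" for m
      using W_bound[of m]
      by eventually_elim (use w_bound[of m] in \<open>simp add: abs_le_iff; linarith\<close>)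
    show "expectation (\<lambda>\<omega>. (W m \<omega> - w m) * (W n \<omega> - w n)) = 0" if "m + k \<le> n" for m n
    proof -
      have "(W m \<omega> - w m) * (W n \<omega> - w n) = W m \<omega> * W n \<omega> - w n * W m \<omega> - w m * W n \<omega> + w m * w n" for \<omega>
        by (simp add: algebra_simps)
      then show ?thesis
        using WW[OF that] W_int W_exp prob_space by (simp add: algebra_simps)
    qed
  qed
  then show ?thesis
    unfolding W_def w_def prod_S[symmetric] .
qed

text \<open>The product of the means is a backward product, periodic in its endpoint. Its average
  therefore converges to a limit that depends neither on the start \<open>a\<close> nor on the
  offset \<open>N\<close>.\<close>

lemma AE_average_window_products_periodic:
  fixes Z :: "nat \<Rightarrow> 'a \<Rightarrow> real"
  assumes indep: "indep_vars (\<lambda>_. borel) Z {1..}"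
    and bound: "\<And>i. i \<ge> 1 \<Longrightarrow> AE \<omega> in M. \<bar>Z i \<omega>\<bar> \<le> C"
    and mean: "\<And>n. expectation (Z (Suc n)) = f (a + int n)"
    and per: "\<And>z. f (z + int I) = f z" and I: "I > 0"
    and k: "k \<le> Suc N"
  shows "AE \<omega> in M. (\<lambda>n. (\<Sum>m<n. \<Prod>l<k. Z (Suc (m + N) - l) \<omega>) / real n)
    \<longlonglongrightarrow> (\<Sum>i<I. backward_prod f k (int i)) / real I"
proof -
  have exp: "(\<Prod>l<k. expectation (Z (Suc (m + N) - l))) = backward_prod f k ((a + int N) + int m)" for m
    unfolding backward_prod_def
  proof (rule prod.cong)
    fix l assume "l \<in> {..<k}"
    then have l: "l \<le> N" using k by simp
    then have "expectation (Z (Suc (m + N) - l)) = f (a + int (m + N - l))"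
      using mean[of "m + N - l"] by (simp add: Suc_diff_le)
    also have "a + int (m + N - l) = (a + int N) + int m - int l"
      using l by simp
    finally show "expectation (Z (Suc (m + N) - l)) = f ((a + int N) + int m - int l)" .
  qed simp
  have lim: "(\<lambda>n. (\<Sum>m<n. backward_prod f k ((a + int N) + int m)) / real n)
      \<longlonglongrightarrow> (\<Sum>i<I. backward_prod f k (int i)) / real I"
    by (rule periodic_average[OF I]) (rule backward_prod_period_add[of f, OF per])
  have "AE \<omega> in M. (\<lambda>n. (\<Sum>m<n. (\<Prod>l<k. Z (Suc (m + N) - l) \<omega>)
      - backward_prod f k ((a + int N) + int m)) / real n) \<longlonglongrightarrow> 0"
    unfolding exp[symmetric] using bound k by (rule AE_average_window_products[OF indep])
  then show ?thesis
  proof eventually_elim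
    case (elim \<omega>)
    from tendsto_add[OF elim lim] show ?case
      by (simp add: sum_subtractf diff_divide_distrib)
  qed
qed

end

section \<open>Limiting frequency of awards\<close>

text \<open>This concerns a single realization: randomness enters only through the run averages
  assumed in \<open>runs\<close>. Runs are truncated at length \<open>N = I * s\<close>, first
  \<open>n\<close> tends to infinity, and then \<open>s\<close> is large.\<close>

lemma award_average_tendsto:
  fixes r :: "nat \<Rightarrow> real"
  assumes J: "J \<ge> 2" and d: "d \<ge> 1" and I: "I = d * J"
    and per: "\<And>z. q (z + int I) = q z"
    and Q: "Q = (\<Prod>i<I. q (int i))" "0 \<le> Q" "Q < 1"
    and runs: "\<And>k N. k \<le> Suc N \<Longrightarrow> (\<lambda>n. (\<Sum>m<n. loss_run r k (Suc (m + N))) / real n)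
      \<longlonglongrightarrow> (\<Sum>i<I. backward_prod q k (int i)) / real I"
  shows "(\<lambda>n. (\<Sum>m<n. award J j0 r (Suc m)) / real n) \<longlonglongrightarrow>
    1 / (real I * (1 - Q)) * (\<Sum>i<I. \<Sum>k<d. backward_prod q (Suc k * J) (int i)
      - backward_prod q (Suc (Suc k * J)) (int i))" (is "?a \<longlonglongrightarrow> ?c")
proof (rule tendsto_of_approximations)
  fix e :: real assume e: "0 < e"
  define E where "E k i = backward_prod q (Suc k * J) (int i) - backward_prod q (Suc (Suc k * J)) (int i)" for k i
  have Ipos: "real I > 0" using J d I by simp
  have E_add: "E (k + d) i = Q * E k i" for k i
    unfolding E_def Q(1) using backward_prod_add_period[of q I "Suc k * J", OF per]
      backward_prod_add_period[of q I "Suc (Suc k * J)", OF per]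
    by (simp add: I algebra_simps)
  have "(\<lambda>s. Q ^ s * (\<bar>?c\<bar> + 1)) \<longlonglongrightarrow> 0 * (\<bar>?c\<bar> + 1)"
    using Q by (intro tendsto_mult tendsto_const LIMSEQ_realpow_zero) auto
  then have "eventually (\<lambda>s. Q ^ s * (\<bar>?c\<bar> + 1) < e) sequentially"
    using e by (intro order_tendstoD) auto
  \<comment> \<open>Truncation displaces the limit by \<open>Q ^ s * \<bar>?c\<bar>\<close>, and the
    error bound tends to \<open>Q ^ s\<close>; the choice of \<open>s\<close> makes their sum less
    than \<open>e\<close>.\<close>
  then obtain s where s: "Q ^ s * (\<bar>?c\<bar> + 1) < e"
    by (auto simp: eventually_sequentially)
  \<comment> \<open>A multiple of \<open>d\<close> makes \<open>N\<close> a whole number of periods,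
    so that the block sum and the error limit have closed forms.\<close>
  define K where "K = d * s"
  define N where "N = K * J"
  define u where "u n = (\<Sum>k<K. (\<Sum>m<n. loss_run r (Suc k * J) (Suc (m + N))) / real n
      - (\<Sum>m<n. loss_run r (Suc (Suc k * J)) (Suc (m + N))) / real n)" for n
  define v where "v n = (\<Sum>m<n. loss_run r N (Suc (m + N))) / real n" for n
  define a' where "a' n = (\<Sum>m<n. award J j0 r (Suc (m + N))) / real n" for n
  \<comment> \<open>Consequently the longer run in each difference has length at most
    \<open>Suc N\<close>, the range that \<open>runs\<close> admits.\<close>
  have kN: "Suc k * J \<le> N" if "k < K" for k
    unfolding N_def using that by (intro mult_le_mono1) simp
  have "u \<longlonglongrightarrow> (\<Sum>k<K. (\<Sum>i<I. backward_prod q (Suc k * J) (int i)) / real I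
      - (\<Sum>i<I. backward_prod q (Suc (Suc k * J)) (int i)) / real I)"
    unfolding u_def using kN by (intro tendsto_sum tendsto_diff runs) (auto simp del: mult_Suc intro: le_SucI)
  also have "(\<Sum>k<K. (\<Sum>i<I. backward_prod q (Suc k * J) (int i)) / real I
      - (\<Sum>i<I. backward_prod q (Suc (Suc k * J)) (int i)) / real I) = (\<Sum>k<K. \<Sum>i<I. E k i) / real I"
    unfolding E_def sum_subtractf diff_divide_distrib sum_divide_distrib ..
  also have "(\<Sum>k<K. \<Sum>i<I. E k i) = (\<Sum>i<I. \<Sum>k<K. E k i)"
    by (rule sum.swap)
  also have "\<dots> = (\<Sum>i<I. (1 - Q ^ s) * (\<Sum>k<d. E k i) / (1 - Q))"
  proof (intro sum.cong refl)
    fix i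
    show "(\<Sum>k<K. E k i) = (1 - Q ^ s) * (\<Sum>k<d. E k i) / (1 - Q)"
      using geometric_block_sum[of "\<lambda>k. E k i" d Q s, OF E_add] Q by (simp add: K_def field_simps)
  qed
  also have "\<dots> / real I = (1 - Q ^ s) * ?c"
    unfolding E_def[symmetric] by (simp add: sum_distrib_left sum_divide_distrib field_simps)
  finally have u: "u \<longlonglongrightarrow> (1 - Q ^ s) * ?c" .
  have v: "v \<longlonglongrightarrow> Q ^ s"
  proof -
    have "N = I * s" by (simp add: N_def K_def I)
    then have "(\<Sum>i<I. backward_prod q N (int i)) / real I = Q ^ s"
      using Ipos backward_prod_power[of q I s, OF per] by (simp add: Q(1))
    then show ?thesis using runs[of N N] unfolding v_def by simp
  qed
  have a'_bound: "\<bar>a' n - u n\<bar> \<le> v n" for n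
  proof -
    have "a' n - u n = (\<Sum>m<n. award J j0 r (Suc (m + N)) - (\<Sum>k<K. loss_run r (Suc k * J) (Suc (m + N))
        - loss_run r (Suc (Suc k * J)) (Suc (m + N)))) / real n"
      unfolding a'_def u_def sum_subtractf diff_divide_distrib sum_divide_distrib
      by (subst (1 2) sum.swap) (simp add: sum_divide_distrib)
    then have "\<bar>a' n - u n\<bar> = \<bar>\<Sum>m<n. award J j0 r (Suc (m + N)) - (\<Sum>k<K. loss_run r (Suc k * J) (Suc (m + N))
        - loss_run r (Suc (Suc k * J)) (Suc (m + N)))\<bar> / real n"
      by simp
    also have "\<dots> \<le> (\<Sum>m<n. loss_run r N (Suc (m + N))) / real n"
      unfolding N_def
      by (intro divide_right_mono order_trans[OF sum_abs] sum_mono award_eq_loss_runs[OF J]) auto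
    finally show ?thesis by (simp add: v_def)
  qed
  have shift: "(\<lambda>n. ?a n - a' n) \<longlonglongrightarrow> 0"
    unfolding a'_def using average_shift_difference[of "\<lambda>m. award J j0 r (Suc m)" 1 N]
    by (simp add: award_def)
  show "\<exists>u v s t. u \<longlonglongrightarrow> s \<and> v \<longlonglongrightarrow> t \<and> (\<forall>n. \<bar>?a n - u n\<bar> \<le> v n) \<and> \<bar>s - ?c\<bar> + t < e"
  proof (intro exI conjI allI)
    \<comment> \<open>The comparison with runs holds only after coup \<open>N\<close>; adding the
      vanishing shift difference transfers it to the average from the first coup on.\<close>
    show "(\<lambda>n. u n + (?a n - a' n)) \<longlonglongrightarrow> (1 - Q ^ s) * ?c"
      using tendsto_add[OF u shift] by simp
    show "v \<longlonglongrightarrow> Q ^ s" by (rule v)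
    show "\<bar>?a n - (u n + (?a n - a' n))\<bar> \<le> v n" for n
      using a'_bound[of n] by simp
    have "(1 - Q ^ s) * ?c - ?c = - (Q ^ s * ?c)" by (simp only: left_diff_distrib)
    then have "\<bar>(1 - Q ^ s) * ?c - ?c\<bar> = Q ^ s * \<bar>?c\<bar>"
      using Q by (simp only: abs_minus_cancel abs_mult) simp
    then show "\<bar>(1 - Q ^ s) * ?c - ?c\<bar> + Q ^ s < e"
      using s by (simp only: distrib_left)
  qed
qed

section \<open>Almost sure limit of the average payout\<close>

theorem theorem2:
  fixes M :: "'a measure"
    and J d I i0 j0 :: nat
    and D :: "nat \<Rightarrow> real measure"
    and R :: "nat \<Rightarrow> 'a \<Rightarrow> real"
  assumes "J \<ge> 2" and "d \<ge> 1" and "I = d * J"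
    and "\<And>i. i < I \<Longrightarrow> payout_distribution (D i)"
    and "\<And>i. i < I \<Longrightarrow> 0 < win_prob (D i) \<and> win_prob (D i) < 1"
    and "i0 < I" and "j0 < J"
    and "prob_space M"
    and "prob_space.indep_vars M (\<lambda>_. borel) R {1..}"
    and "\<And>n. n \<ge> 1 \<Longrightarrow> distr M borel (R n) = D (cam_position I i0 (n - 1))"
  shows "AE \<omega> in M.
    (\<lambda>n. (\<Sum>m=1..n. total_payout J j0 (\<lambda>k. R k \<omega>) m) / real n)
      \<longlonglongrightarrow> futurity_mean d J D"
proof -
  interpret prob_space M by fact
  note J = assms(1) and d = assms(2) and I = assms(3) and indep = assms(9)
  have Ipos: "I > 0" using J d I by simp
  define c where "c n = cam_position I i0 n" for n
  have c: "c n < I" for n using Ipos by (simp add: c_def cam_position_def)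
  have law: "distr M borel (R (Suc n)) = D (c n)" for n
    using assms(10)[of "Suc n"] by (simp add: c_def)
  have R_meas[measurable]: "random_variable borel (R i)" if "i \<in> {1..}" for i
    using indep that by (simp add: indep_vars_def)
  define f where "f = periodic_ext I (\<lambda>i. mean_payout (D i))"
  define p where "p = periodic_ext I (\<lambda>i. win_prob (D i))"
  define q where "q z = 1 - p z" for z
  have ext_nat: "periodic_ext I g (int i) = g i" if "i < I" for g i
    using that by (simp add: periodic_ext_def)
  have ext_c: "periodic_ext I g (int i0 + int n) = g (c n)" for g n
    by (simp add: periodic_ext_def c_def cam_position_def nat_mod_distrib flip: of_nat_add)
  have f_per: "f (z + int I) = f z" and q_per: "q (z + int I) = q z" for z
    by (simp_all add: f_def q_def p_def periodic_ext_def)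

  obtain B where B: "\<And>i. i < I \<Longrightarrow> AE x in D i. 0 \<le> x \<and> x \<le> B i"
    using assms(4) unfolding payout_distribution_def by metis
  \<comment> \<open>The bounds depend on the cam position; this sum dominates all of them.\<close>
  define C where "C = (\<Sum>i<I. \<bar>B i\<bar>)"
  have R_bound: "AE \<omega> in M. \<bar>R n \<omega>\<bar> \<le> C" if "n \<ge> 1" for n
  proof -
    obtain n' where n: "n = Suc n'" using \<open>n \<ge> 1\<close> by (cases n) auto
    have "AE x in distr M borel (R n). 0 \<le> x \<and> x \<le> B (c n')"
      unfolding n law by (rule B[OF c])
    then have "AE \<omega> in M. 0 \<le> R n \<omega> \<and> R n \<omega> \<le> B (c n')"
      using \<open>n \<ge> 1\<close> by (subst (asm) AE_distr_iff) auto
    then show ?thesis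
    proof eventually_elim
      case (elim \<omega>)
      have "\<bar>B (c n')\<bar> \<le> C"
        unfolding C_def using c by (intro member_le_sum) auto
      with elim show ?case by simp
    qed
  qed
  have R_mean: "expectation (R (Suc n)) = f (int i0 + int n)" for n
    unfolding f_def ext_c mean_payout_def law[symmetric] by (subst integral_distr) auto

  define Z where "Z i \<omega> = (of_bool (R i \<omega> = 0) :: real)" for i \<omega>
  have Z_indep: "indep_vars (\<lambda>_. borel) Z {1..}"
    unfolding Z_def by (rule indep_vars_compose2[OF indep]) measurable
  have Z_mean: "expectation (Z (Suc n)) = q (int i0 + int n)" for n
  proof -
    have "expectation (Z (Suc n)) = prob {\<omega> \<in> space M. R (Suc n) \<omega> = 0}"
    proof -
      have "expectation (Z (Suc n)) = expectation (indicator {\<omega> \<in> space M. R (Suc n) \<omega> = 0})"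
        unfolding Z_def by (intro Bochner_Integration.integral_cong) (auto simp: indicator_def)
      then show ?thesis by simp
    qed
    also have "\<dots> = 1 - prob {\<omega> \<in> space M. R (Suc n) \<omega> \<noteq> 0}"
      by (subst prob_neg[symmetric]) auto
    also have "prob {\<omega> \<in> space M. R (Suc n) \<omega> \<noteq> 0} = win_prob (D (c n))"
      unfolding win_prob_def law[symmetric]
      by (subst measure_distr) (auto intro!: arg_cong[of _ _ prob])
    finally show ?thesis by (simp add: q_def p_def ext_c)
  qed

  define Q where "Q = (\<Prod>i<I. q (int i))"
  have q_bounds: "0 < q (int i)" "q (int i) < 1" if "i < I" for i
    using assms(5)[OF that] by (simp_all add: q_def p_def ext_nat[OF that])
  have Q: "0 \<le> Q" "Q < 1"
  proof -
    show "0 \<le> Q" unfolding Q_def using q_bounds by (intro prod_nonneg) (auto intro: less_imp_le)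
    have "Q < (\<Prod>i<I. 1)" unfolding Q_def
      using q_bounds Ipos by (intro prod_mono_strict) (auto intro: less_imp_le)
    then show "Q < 1" by simp
  qed
  \<comment> \<open>Extending a window by one factor \<open>q\<close> and subtracting leaves the
    factor \<open>1 - q = p\<close> at \<open>i - k * J\<close>: the win just before the run. The
    index \<open>k = 1..d\<close> becomes \<open>Suc k\<close> with \<open>k < d\<close>.\<close>
  have rate: "award_rate d J (\<lambda>i. win_prob (D i)) = 1 / (real I * (1 - Q)) *
      (\<Sum>i<I. \<Sum>k<d. backward_prod q (Suc k * J) (int i) - backward_prod q (Suc (Suc k * J)) (int i))"
    unfolding award_rate_def Let_def I[symmetric] p_def[symmetric] q_def[symmetric] Q_def[symmetric]
      One_nat_def sum.atLeast1_atMost_eq backward_prod_Suc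
    by (simp only: backward_prod_def) (simp add: q_def algebra_simps)

  have Z_bound: "\<bar>Z i \<omega>\<bar> \<le> 1" for i \<omega>
    by (simp add: Z_def)
  have "AE \<omega> in M. (\<lambda>n. (\<Sum>m<n. \<Prod>l<k. Z (Suc (m + N) - l) \<omega>) / real n)
      \<longlonglongrightarrow> (\<Sum>i<I. backward_prod q k (int i)) / real I" if "k \<le> Suc N" for k N
    by (rule AE_average_window_products_periodic[where C = 1 and a = "int i0"])
      (use Z_indep Z_bound Z_mean q_per Ipos that in auto)
  \<comment> \<open>Only countably many pairs \<open>k\<close>, \<open>N\<close> occur, so one null
    set serves them all.\<close>
  then have "AE \<omega> in M. \<forall>k N. k \<le> Suc N \<longrightarrow> (\<lambda>n. (\<Sum>m<n. \<Prod>l<k. Z (Suc (m + N) - l) \<omega>) / real n)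
      \<longlonglongrightarrow> (\<Sum>i<I. backward_prod q k (int i)) / real I"
    unfolding AE_all_countable by auto
  \<comment> \<open>Windows of length 1 give the strong law for the payouts without awards.\<close>
  moreover have "AE \<omega> in M. (\<lambda>n. (\<Sum>m<n. \<Prod>l<1. R (Suc (m + 0) - l) \<omega>) / real n)
      \<longlonglongrightarrow> (\<Sum>i<I. backward_prod f 1 (int i)) / real I"
    by (rule AE_average_window_products_periodic[where C = C and a = "int i0"])
      (use indep R_bound R_mean f_per Ipos in auto)
  ultimately show ?thesis
  proof eventually_elim
    case (elim \<omega>)
    let ?r = "\<lambda>k. R k \<omega>"
    \<comment> \<open>A product of loss indicators over a window is the indicator of a run, which
      turns the window averages into the hypothesis \<open>runs\<close>.\<close>
    have "(\<Prod>l<k. Z (n - l) \<omega>) = loss_run ?r k n" for k n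
      unfolding Z_def loss_run_def by (induction k) (auto simp: less_Suc_eq)
    then have "(\<lambda>n. (\<Sum>m<n. award J j0 ?r (Suc m)) / real n) \<longlonglongrightarrow> award_rate d J (\<lambda>i. win_prob (D i))"
      unfolding rate using elim(1) Q q_per J d I
      by (intro award_average_tendsto) (auto simp: Q_def)
    moreover have "(\<lambda>n. (\<Sum>m<n. R (Suc m) \<omega>) / real n) \<longlonglongrightarrow> (\<Sum>i<I. mean_payout (D i)) / real I"
      using elim(2) by (simp add: backward_prod_def f_def ext_nat)
    ultimately have "(\<lambda>n. (\<Sum>m<n. R (Suc m) \<omega>) / real n + real J * ((\<Sum>m<n. award J j0 ?r (Suc m)) / real n))
        \<longlonglongrightarrow> (\<Sum>i<I. mean_payout (D i)) / real I + real J * award_rate d J (\<lambda>i. win_prob (D i))"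
      by (intro tendsto_add tendsto_mult tendsto_const)
    moreover have "(\<Sum>m<n. R (Suc m) \<omega>) / real n + real J * ((\<Sum>m<n. award J j0 ?r (Suc m)) / real n)
        = (\<Sum>m=1..n. total_payout J j0 ?r m) / real n" for n
      unfolding One_nat_def sum.atLeast1_atMost_eq total_payout_eq
      by (simp add: sum.distrib add_divide_distrib flip: sum_distrib_left)
    ultimately show ?case
      by (simp add: futurity_mean_def I)
  qed
qed

end
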